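(* Let $k \ge 2$ be an even integer. For all oriented graphs $L$ and $R$ with $\mathrm{inv}(L)=1$ and $\mathrm{inv}(R)=k$, we have $$\mathrm{inv}(L \Rightarrow R)=\mathrm{inv}(R \Rightarrow L)=\mathrm{inv}(L)+\mathrm{inv}(R)=1+k.$$
   Context: All digraphs are finite and have no loops, parallel arcs or 2-cycles (i.e. they are oriented graphs). For a digraph $D$ with vertex set $V(D)$ and a subset $X\subseteq V(D)$, the inversion of $X$ in $D$ is the digraph $\mathrm{Inv}(D;X)$ obtained from $D$ by reversing the direction of all arcs with both ends in $X$. For a finite family $(X_i)_{i\in I}$ of subsets of $V(D)$, $\mathrm{Inv}(D;(X_i)_{i\in I})$ is obtained by inverting the sets $X_i$ one after another (the order does not matter). The family is a decycling family if $\mathrm{Inv}(D;(X_i)_{i\in I})$ is acyclic. The inversion number $\mathrm{inv}(D)$ is the minimum cardinality $|I|$ of a decycling family of $D$. For (vertex-disjoint) oriented graphs $L,R$, the dijoin $L\Rightarrow R$ is the oriented graph obtained from the disjoint union of $L$ and $R$ by adding all arcs $uv$ with $u\in V(L)$, $v\in V(R)$. *)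

theory Defs
  imports "Graph_Theory.Pair_Digraph"
begin

locale oriented_graph = pair_digraph +
  assumes no_2cycles: "(u, v) \<in> parcs G \<Longrightarrow> (v, u) \<notin> parcs G"

definition acyclic_digraph :: "'a pair_pre_digraph \<Rightarrow> bool" where
  "acyclic_digraph D \<longleftrightarrow> \<not> (\<exists>p. pre_digraph.cycle (with_proj D) p)"

definition invert :: "'a pair_pre_digraph \<Rightarrow> 'a set \<Rightarrow> 'a pair_pre_digraph" where
  "invert D X = \<lparr> pverts = pverts D,
     parcs = {(u, v). (u, v) \<in> parcs D \<and> \<not> (u \<in> X \<and> v \<in> X)}
           \<union> {(v, u) | u v. (u, v) \<in> parcs D \<and> u \<in> X \<and> v \<in> X} \<rparr>"

text \<open>
  A finite family of vertex sets is a list, so that a set may occur several times. The sets are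
  inverted from left to right; by \<open>invert_commute\<close> below the order is irrelevant.
\<close>

definition invert_family :: "'a pair_pre_digraph \<Rightarrow> 'a set list \<Rightarrow> 'a pair_pre_digraph" where
  "invert_family D Xs = foldl invert D Xs"

definition decycling_family :: "'a pair_pre_digraph \<Rightarrow> 'a set list \<Rightarrow> bool" where
  "decycling_family D Xs \<longleftrightarrow>
     (\<forall>X\<in>set Xs. X \<subseteq> pverts D) \<and> acyclic_digraph (invert_family D Xs)"

text \<open>The minimum exists for every oriented graph, see \<open>ex_decycling_family\<close> below.\<close>

definition inversion_number :: "'a pair_pre_digraph \<Rightarrow> nat" where
  "inversion_number D = (LEAST n. \<exists>Xs. decycling_family D Xs \<and> length Xs = n)"

text \<open>Only meaningful when the vertex sets of the two digraphs are disjoint.\<close>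

definition dijoin :: "'a pair_pre_digraph \<Rightarrow> 'a pair_pre_digraph \<Rightarrow> 'a pair_pre_digraph" where
  "dijoin L R = \<lparr> pverts = pverts L \<union> pverts R,
     parcs = parcs L \<union> parcs R \<union> pverts L \<times> pverts R \<rparr>"

lemma pverts_invert [simp]: "pverts (invert D X) = pverts D"
  by (simp add: invert_def)

lemma in_parcs_invert_iff:
  "(u, v) \<in> parcs (invert D X) \<longleftrightarrow>
     (if u \<in> X \<and> v \<in> X then (v, u) \<in> parcs D else (u, v) \<in> parcs D)"
  by (auto simp: invert_def)

lemma invert_commute: "invert (invert D X) Y = invert (invert D Y) X"
proof (rule pair_pre_digraph.equality)
  show "parcs (invert (invert D X) Y) = parcs (invert (invert D Y) X)"
    by (rule set_eqI, rename_tac e, case_tac e) (simp add: in_parcs_invert_iff)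
qed simp_all

lemma oriented_graphI:
  assumes "finite (pverts D)" "parcs D \<subseteq> pverts D \<times> pverts D"
    "\<And>u v. (u, v) \<in> parcs D \<Longrightarrow> (v, u) \<notin> parcs D"
  shows "oriented_graph D"
proof
  show "finite (parcs D)"
    using assms(1,2) by (meson finite_SigmaI finite_subset)
  show "fst e \<noteq> snd e" if "e \<in> parcs D" for e
    using that assms(3)[of "fst e" "snd e"] by (cases e) auto
qed (use assms in auto)

lemma oriented_graph_invert:
  assumes "oriented_graph D"
  shows "oriented_graph (invert D X)"
proof -
  interpret oriented_graph D by fact
  show ?thesis
  proof (rule oriented_graphI)
    show "parcs (invert D X) \<subseteq> pverts (invert D X) \<times> pverts (invert D X)"
      using in_arcsD1 in_arcsD2 by (auto simp: in_parcs_invert_iff split: if_splits)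
    show "(v, u) \<notin> parcs (invert D X)" if "(u, v) \<in> parcs (invert D X)" for u v
      using that no_2cycles by (auto simp: in_parcs_invert_iff split: if_splits)
  qed (simp add: pair_finite_verts)
qed

lemma oriented_graph_dijoin:
  assumes "oriented_graph L" "oriented_graph R" "pverts L \<inter> pverts R = {}"
  shows "oriented_graph (dijoin L R)"
proof -
  interpret L: oriented_graph L by fact
  interpret R: oriented_graph R by fact
  show ?thesis
  proof (rule oriented_graphI)
    show "finite (pverts (dijoin L R))"
      by (simp add: dijoin_def L.pair_finite_verts R.pair_finite_verts)
    show "parcs (dijoin L R) \<subseteq> pverts (dijoin L R) \<times> pverts (dijoin L R)"
      using L.in_arcsD1 L.in_arcsD2 R.in_arcsD1 R.in_arcsD2 by (auto simp: dijoin_def)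
    show "(v, u) \<notin> parcs (dijoin L R)" if "(u, v) \<in> parcs (dijoin L R)" for u v
      using that assms(3) L.no_2cycles R.no_2cycles
      by (auto simp: dijoin_def disjoint_iff
          dest: L.in_arcsD1 L.in_arcsD2 R.in_arcsD1 R.in_arcsD2)
  qed
qed

lemma acyclic_digraph_iff:
  assumes "pair_wf_digraph D"
  shows "acyclic_digraph D \<longleftrightarrow> acyclic (parcs D)"
proof -
  interpret pair_wf_digraph D by fact
  have "(\<exists>p. cycle p) \<longleftrightarrow> (\<exists>u. (u, u) \<in> (parcs D)\<^sup>+)"
  proof
    assume "\<exists>p. cycle p"
    then obtain p u where "awalk u p u" "p \<noteq> []" by (auto simp: cycle_def)
    then show "\<exists>u. (u, u) \<in> (parcs D)\<^sup>+" using reachable1_awalk by auto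
  next
    assume "\<exists>u. (u, u) \<in> (parcs D)\<^sup>+"
    then obtain p u where "awalk u p u" "p \<noteq> []" using reachable1_awalk by auto
    then have "closed_w p" by (auto simp: closed_w_def)
    then show "\<exists>p. cycle p" by (rule closed_w_imp_cycle)
  qed
  then show ?thesis by (auto simp: acyclic_digraph_def acyclic_def)
qed

lemma ex_decycling_family:
  assumes "oriented_graph D"
  shows "\<exists>Xs. decycling_family D Xs"
proof -
  interpret D: oriented_graph D by fact
  obtain f :: "'a \<Rightarrow> nat" where f: "inj_on f (pverts D)"
    using finite_imp_inj_to_nat_seg[OF D.pair_finite_verts] by blast
  let ?B = "\<lambda>E. {(u, v). (u, v) \<in> parcs E \<and> f v < f u}"
  have "\<exists>Xs. decycling_family E Xs" if "oriented_graph E" "inj_on f (pverts E)" for E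
    using that
  proof (induction "card (?B E)" arbitrary: E rule: less_induct)
    case less
    interpret E: oriented_graph E by fact
    show ?case
    proof (cases "?B E = {}")
      case True
      have "parcs E \<subseteq> measure f"
      proof
        fix e assume e: "e \<in> parcs E"
        obtain u v where uv: "e = (u, v)" by (cases e)
        have "f u \<noteq> f v"
          using e uv less.prems(2) E.in_arcsD1 E.in_arcsD2 E.no_2cycles
          by (metis inj_on_def)
        then show "e \<in> measure f" using True e uv by (auto simp: not_less le_less)
      qed
      then have "acyclic (parcs E)"
        by (meson wf_acyclic wf_measure wf_subset)
      then have "decycling_family E []"
        by (simp add: decycling_family_def invert_family_def acyclic_digraph_iff[OF E.pair_wf_digraph])
      then show ?thesis ..
    next
      case False
      then obtain u v where uv: "(u, v) \<in> parcs E" "f v < f u" by auto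
      let ?E = "invert E {u, v}"
      have fin: "finite (?B E)"
        by (rule finite_subset[OF _ E.pair_finite_arcs]) auto
      have "(u, v) \<in> ?B E" "(u, v) \<notin> ?B ?E"
        using uv E.no_2cycles by (auto simp: in_parcs_invert_iff)
      moreover have "?B ?E \<subseteq> ?B E"
        using uv E.no_2cycles by (auto simp: in_parcs_invert_iff split: if_splits)
      ultimately have "?B ?E \<subset> ?B E" by blast
      then have "card (?B ?E) < card (?B E)"
        using fin by (rule psubset_card_mono[rotated])
      then obtain Xs where "decycling_family ?E Xs"
        using less.hyps[of ?E] less.prems oriented_graph_invert[of E] by auto
      then have "decycling_family E ({u, v} # Xs)"
        using uv E.in_arcsD1 E.in_arcsD2
        by (auto simp: decycling_family_def invert_family_def)
      then show ?thesis ..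
    qed
  qed
  then show ?thesis using f D.oriented_graph_axioms by blast
qed

end

theory Submission
  imports Defs "HOL-Library.Z2"
begin

text \<open>
  A family of \<open>k\<close> vertex sets assigns to each vertex \<open>v\<close> its incidence vector \<open>x\<^sub>v\<close> in
  \<open>F\<^sub>2\<^sup>k\<close>, and inverting the family reverses exactly the arcs \<open>uv\<close> with
  \<open>x\<^sub>u \<cdot> x\<^sub>v = 1\<close>. So \<open>inv D\<close> is the least dimension of an assignment of vectors whose
  products turn \<open>D\<close> into an acyclic digraph (\<open>inversion_number_attained\<close>,
  \<open>inversion_number_le_card\<close>).

  Families for \<open>L\<close> and for \<open>R\<close> together decycle \<open>L \<Rightarrow> R\<close>, which gives the upper bound
  \<open>1 + k\<close>. For the lower bound, suppose that dimension \<open>k = inv R\<close> suffices for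
  \<open>L \<Rightarrow> R\<close>. Since \<open>L\<close> is not acyclic, some arc of \<open>L\<close> is reversed. A vertex \<open>s\<close> of
  \<open>L\<close> with vector \<open>u\<close> is joined to all of \<open>R\<close>, so it splits the acyclic reorientation of
  \<open>R\<close> into the part before \<open>s\<close>, where \<open>u \<cdot> x\<^sub>v = 1\<close>, and the part after \<open>s\<close>. There are
  two cases, and in each of them the form \<open>x \<cdot> y\<close> on the vectors of \<open>R\<close> can be replaced by
  one that still yields an acyclic digraph but is realised in dimension \<open>k - 1\<close>, which
  contradicts the choice of \<open>k\<close> (\<open>inversion_number_less_of_dijoin\<close>).

  \<^item> If \<open>u \<cdot> u = 1\<close> for some such \<open>u\<close>, reverse all arcs within the part before \<open>s\<close>. The
    form becomes \<open>x \<cdot> y + (u \<cdot> x) (u \<cdot> y)\<close>, with \<open>u\<close> in its radical. It is realised in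
    dimension \<open>k - 1\<close> provided that \<open>u\<close> is not the all-ones vector
    (\<open>drop_coordinate_nonisotropic\<close>), and for even \<open>k\<close> the latter has product \<open>0\<close> with
    itself.
  \<^item> Otherwise the ends of a reversed arc of \<open>L\<close> have vectors \<open>u\<close>, \<open>w\<close> with
    \<open>u \<cdot> u = w \<cdot> w = 0\<close> and \<open>u \<cdot> w = 1\<close>. They split \<open>R\<close> into three consecutive parts.
    Exchanging the first two adds \<open>(u \<cdot> x) (w \<cdot> y) + (w \<cdot> x) (u \<cdot> y)\<close> to the form, which
    makes it the form of the projection along the hyperbolic plane spanned by \<open>u\<close> and \<open>w\<close>
    (\<open>drop_coordinate_hyperbolic\<close>).

  Reversing all arcs turns \<open>R \<Rightarrow> L\<close> into a dijoin whose first factor is the converse of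
  \<open>L\<close>, and it does not change inversion numbers.
\<close>

section \<open>The standard bilinear form over the field with two elements\<close>

text \<open>
  By default \<open>+\<close> and \<open>*\<close> on \<^typ>\<open>bit\<close> are rewritten to bitwise operations, which hides
  sums and products from the ring laws.
\<close>

declare add_bit_eq_xor [simp del] mult_bit_eq_and [simp del]

lemma bit_add_self: "a + a = (0 :: bit)"
  by (cases a) simp_all

definition dot :: "'i set \<Rightarrow> ('i \<Rightarrow> bit) \<Rightarrow> ('i \<Rightarrow> bit) \<Rightarrow> bit" where
  "dot I x y = (\<Sum>i\<in>I. x i * y i)"

lemma dot_commute: "dot I x y = dot I y x"
  by (simp add: dot_def mult.commute)

lemma dot_add_left: "dot I (\<lambda>i. x i + y i) z = dot I x z + dot I y z"
  by (simp add: dot_def distrib_right sum.distrib)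

lemma dot_scale_left: "dot I (\<lambda>i. a * x i) z = a * dot I x z"
  by (simp add: dot_def sum_distrib_left mult.assoc)

lemma dot_add_right: "dot I z (\<lambda>i. x i + y i) = dot I z x + dot I z y"
  by (simp add: dot_commute[of I z] dot_add_left)

lemma dot_scale_right: "dot I z (\<lambda>i. a * x i) = a * dot I z x"
  by (simp add: dot_commute[of I z] dot_scale_left)

lemmas dot_bilinear = dot_add_left dot_scale_left dot_add_right dot_scale_right

lemma dot_unit_left:
  assumes "finite I" "j \<in> I"
  shows "dot I (\<lambda>i. of_bool (i = j)) x = x j"
proof -
  have "dot I (\<lambda>i. of_bool (i = j)) x = (\<Sum>i\<in>I. if i = j then x i else 0)"
    unfolding dot_def by (rule sum.cong) auto
  then show ?thesis using assms by simp
qed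

lemma dot_remove:
  assumes "finite I" "j \<in> I"
  shows "dot (I - {j}) x y = dot I x y + x j * y j"
proof -
  have "dot I x y = x j * y j + dot (I - {j}) x y"
    unfolding dot_def by (rule sum.remove[OF assms])
  then show ?thesis by (cases "x j * y j") (simp_all add: add.assoc[symmetric])
qed

text \<open>
  The right-hand side is the form with matrix \<open>1 + u u\<^sup>T\<close>, which has \<open>u\<close> in its radical because
  \<open>u \<cdot> u = 1\<close>. The vector \<open>c = u + e\<^sub>j\<close> satisfies \<open>c \<cdot> c = 0\<close> and \<open>c \<cdot> u = 1\<close>, so the
  transvection \<open>x \<mapsto> x + (c \<cdot> x) c\<close> is an isometry that takes \<open>u\<close> to \<open>e\<^sub>j\<close>. It turns \<open>u \<cdot> x\<close>
  into the coordinate \<open>j\<close>, and adding \<open>(u \<cdot> x) (u \<cdot> y)\<close> amounts to deleting this coordinate.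
\<close>

lemma drop_coordinate_nonisotropic:
  assumes "finite I" "dot I u u = 1" "j \<in> I" "u j = 0"
  obtains T where "\<And>x y. dot (I - {j}) (T x) (T y) = dot I x y + dot I u x * dot I u y"
proof
  fix x y
  define c where "c = (\<lambda>i. u i + of_bool (i = j))"
  define T where "T = (\<lambda>x i. x i + dot I c x * c i)"
  have c: "dot I c x = dot I u x + x j" for x
    unfolding c_def dot_add_left using assms by (simp add: dot_unit_left)
  have cj: "c j = 1" using assms(4) by (simp add: c_def)
  have "dot I c u = 1" using assms by (simp add: c)
  then have cc: "dot I c c = 0"
    using cj assms by (simp add: c dot_commute[of I u c])
  have "dot I (T x) (T y) = dot I x y" for x y
    unfolding T_def dot_bilinear cc dot_commute[of I x c]
    by (simp add: mult.commute bit_add_self add.assoc)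
  moreover have "T x j = dot I u x" for x
    by (simp add: T_def c cj add.commute[of "dot I u x"] add.assoc[symmetric] bit_add_self)
  ultimately show "dot (I - {j}) (T x) (T y) = dot I x y + dot I u x * dot I u y"
    using assms by (simp add: dot_remove)
qed

text \<open>
  The right-hand side is the form \<open>P x \<cdot> P y\<close>, where \<open>P x = x + (w \<cdot> x) u + (u \<cdot> x) w\<close> is the
  orthogonal projection along the hyperbolic plane spanned by \<open>u\<close> and \<open>w\<close>. The image of \<open>P\<close>
  is orthogonal to \<open>u\<close>, so adding multiples of the isotropic vector \<open>u\<close> to \<open>P x\<close> does not
  change these products. Some coordinate \<open>u\<^sub>j\<close> is \<open>1\<close>; a suitable multiple makes coordinate
  \<open>j\<close> of \<open>P x\<close> vanish, and then this coordinate can be deleted.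
\<close>

lemma drop_coordinate_hyperbolic:
  assumes "finite I" "dot I u u = 0" "dot I w w = 0" "dot I u w = 1"
  obtains j T where "j \<in> I"
    "\<And>x y. dot (I - {j}) (T x) (T y)
        = dot I x y + dot I u x * dot I w y + dot I w x * dot I u y"
proof -
  have "(\<Sum>i\<in>I. u i * w i) \<noteq> 0"
    using assms(4) by (simp add: dot_def)
  then obtain j where "j \<in> I" "u j * w j \<noteq> 0"
    by (rule sum.not_neutral_contains_not_neutral)
  then have j: "j \<in> I" "u j = 1" by (cases "u j"; simp)+
  define P where "P = (\<lambda>x i. (x i + dot I w x * u i) + dot I u x * w i)"
  define T where "T = (\<lambda>x i. P x i + P x j * u i)"
  have wu: "dot I w u = 1" using assms(4) by (simp add: dot_commute)
  have uP: "dot I u (P x) = 0" for x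
    by (simp add: P_def dot_bilinear assms wu bit_add_self)
  have "dot I (P x) (P y) = dot I x y + dot I u x * dot I w y + dot I w x * dot I u y" for x y
    unfolding P_def dot_bilinear assms wu dot_commute[of I x u] dot_commute[of I x w]
    by (cases "dot I u x"; cases "dot I w x"; cases "dot I u y"; cases "dot I w y";
        cases "dot I x y") simp_all
  moreover have "dot I (T x) (T y) = dot I (P x) (P y)" for x y
    by (simp add: T_def dot_bilinear assms uP dot_commute[of I "P x" u])
  moreover have "T x j = 0" for x
    using j by (simp add: T_def bit_add_self)
  ultimately show thesis
    using that[of j T] j assms(1) by (simp add: dot_remove)
qed


section \<open>Decycling families as assignments of vectors\<close>

definition reorient :: "('a \<times> 'a) set \<Rightarrow> ('a \<Rightarrow> 'a \<Rightarrow> bit) \<Rightarrow> ('a \<times> 'a) set" where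
  "reorient E g = {(u, v). if g u v = 1 then (v, u) \<in> E else (u, v) \<in> E}"

lemma in_reorient_iff:
  "(u, v) \<in> reorient E g \<longleftrightarrow> (if g u v = 1 then (v, u) \<in> E else (u, v) \<in> E)"
  by (simp add: reorient_def)

lemma pverts_invert_family [simp]: "pverts (invert_family D Xs) = pverts D"
  unfolding invert_family_def by (induction Xs arbitrary: D) simp_all

lemma oriented_graph_invert_family:
  "oriented_graph D \<Longrightarrow> oriented_graph (invert_family D Xs)"
  unfolding invert_family_def by (induction Xs arbitrary: D) (simp_all add: oriented_graph_invert)

lemma parcs_invert_family:
  "parcs (invert_family D Xs)
    = reorient (parcs D) (\<lambda>u v. \<Sum>X\<leftarrow>Xs. of_bool (u \<in> X \<and> v \<in> X))"
proof -
  have "(u, v) \<in> parcs (invert_family D Xs) \<longleftrightarrow>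
    (if (\<Sum>X\<leftarrow>Xs. of_bool (u \<in> X \<and> v \<in> X)) = (1::bit) then (v, u) \<in> parcs D else (u, v) \<in> parcs D)"
    for u v
  proof (induction Xs arbitrary: D)
    case Nil
    then show ?case by (simp add: invert_family_def)
  next
    case (Cons X Xs)
    have "invert_family D (X # Xs) = invert_family (invert D X) Xs"
      by (simp add: invert_family_def)
    then show ?case
      by (cases "(\<Sum>X\<leftarrow>Xs. of_bool (u \<in> X \<and> v \<in> X)) :: bit")
        (auto simp: Cons.IH in_parcs_invert_iff)
  qed
  then show ?thesis by (auto simp: reorient_def)
qed

lemma decycling_family_iff:
  assumes "oriented_graph D"
  shows "decycling_family D Xs \<longleftrightarrow> (\<forall>X\<in>set Xs. X \<subseteq> pverts D) \<and>
    acyclic (reorient (parcs D) (\<lambda>u v. \<Sum>X\<leftarrow>Xs. of_bool (u \<in> X \<and> v \<in> X)))"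
proof -
  interpret oriented_graph "invert_family D Xs"
    using assms by (rule oriented_graph_invert_family)
  show ?thesis
    by (simp add: decycling_family_def acyclic_digraph_iff[OF pair_wf_digraph] parcs_invert_family)
qed

text \<open>The vector of a vertex lists the members of the family that contain it.\<close>

lemma inversion_number_attained:
  assumes "oriented_graph D"
  obtains x where
    "acyclic (reorient (parcs D) (\<lambda>u v. dot {..<inversion_number D} (x u) (x v)))"
proof -
  have "\<exists>n Xs. decycling_family D Xs \<and> length Xs = n"
    using ex_decycling_family[OF assms] by blast
  then have "\<exists>Xs. decycling_family D Xs \<and> length Xs = inversion_number D"
    unfolding inversion_number_def by (rule LeastI_ex)
  then obtain Xs where Xs: "decycling_family D Xs" "length Xs = inversion_number D" by blast
  have "(\<Sum>X\<leftarrow>Xs. of_bool (u \<in> X \<and> v \<in> X))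
      = dot {..<inversion_number D} (\<lambda>i. of_bool (u \<in> Xs ! i)) (\<lambda>i. of_bool (v \<in> Xs ! i))" for u v
    using Xs(2) by (simp add: dot_def sum_list_sum_nth atLeast0LessThan of_bool_conj)
  then show thesis
    using Xs(1) that[of "\<lambda>u i. of_bool (u \<in> Xs ! i)"] by (simp add: decycling_family_iff[OF assms])
qed

lemma inversion_number_le_card:
  assumes D: "oriented_graph D" and I: "finite I"
    and ac: "acyclic (reorient (parcs D) (\<lambda>u v. dot I (x u) (x v)))"
  shows "inversion_number D \<le> card I"
proof -
  interpret D: oriented_graph D by fact
  obtain js where js: "set js = I" "distinct js"
    using finite_distinct_list[OF I] by blast
  define Xs where "Xs = map (\<lambda>i. {v \<in> pverts D. x v i = 1}) js"
  have sum: "(\<Sum>X\<leftarrow>Xs. of_bool (u \<in> X \<and> v \<in> X)) = dot I (x u) (x v)"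
    if "u \<in> pverts D" "v \<in> pverts D" for u v
  proof -
    have "of_bool (x u i = 1 \<and> x v i = 1) = x u i * x v i" for i
      by (cases "x u i"; cases "x v i") simp_all
    then have "(\<Sum>X\<leftarrow>Xs. of_bool (u \<in> X \<and> v \<in> X)) = (\<Sum>i\<leftarrow>js. x u i * x v i)"
      using that by (simp add: Xs_def o_def)
    then show ?thesis
      using js by (simp add: dot_def sum_list_distinct_conv_sum_set)
  qed
  have "reorient (parcs D) (\<lambda>u v. \<Sum>X\<leftarrow>Xs. of_bool (u \<in> X \<and> v \<in> X))
      \<subseteq> reorient (parcs D) (\<lambda>u v. dot I (x u) (x v))"
  proof (rule subrelI)
    fix u v
    assume uv: "(u, v) \<in> reorient (parcs D) (\<lambda>u v. \<Sum>X\<leftarrow>Xs. of_bool (u \<in> X \<and> v \<in> X))"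
    then have "u \<in> pverts D" "v \<in> pverts D"
      using D.in_arcsD1 D.in_arcsD2 by (auto simp: in_reorient_iff split: if_splits)
    then show "(u, v) \<in> reorient (parcs D) (\<lambda>u v. dot I (x u) (x v))"
      using uv by (simp add: in_reorient_iff sum)
  qed
  then have "decycling_family D Xs"
    using ac by (auto simp: decycling_family_iff[OF D] Xs_def intro: acyclic_subset)
  then have "inversion_number D \<le> length Xs"
    unfolding inversion_number_def by (intro Least_le) blast
  also have "length Xs = card I"
    using js by (simp add: Xs_def distinct_card[symmetric])
  finally show ?thesis .
qed

text \<open>
  A closed walk along which \<open>h\<close> never decreases stays on one level. Hence arcs within a level
  may be reversed, and levels may be permuted, independently of each other.
\<close>

lemma acyclic_by_levels:
  fixes h :: "'a \<Rightarrow> nat"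
  assumes mono: "\<And>a b. (a, b) \<in> E \<Longrightarrow> h a \<le> h b"
    and level: "\<And>n. acyclic {(a, b) \<in> E. h a = n \<and> h b = n}"
  shows "acyclic E"
proof -
  let ?E = "\<lambda>n. {(a, b) \<in> E. h a = n \<and> h b = n}"
  have "h a \<le> h b \<and> (h b \<le> h a \<longrightarrow> (a, b) \<in> (?E (h a))\<^sup>+)" if "(a, b) \<in> E\<^sup>+" for a b
    using that
  proof (induction rule: trancl_induct)
    case (base b)
    then show ?case using mono[of a b] by auto
  next
    case (step b c)
    then have "h b \<le> h c" using mono by blast
    show ?case
    proof (intro conjI impI)
      show "h a \<le> h c" using step.IH \<open>h b \<le> h c\<close> by simp
      assume "h c \<le> h a"
      then have "(a, b) \<in> (?E (h a))\<^sup>+" "(b, c) \<in> ?E (h a)"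
        using step \<open>h b \<le> h c\<close> by auto
      then show "(a, c) \<in> (?E (h a))\<^sup>+" by (rule trancl_into_trancl)
    qed
  qed
  then show ?thesis using level by (fastforce simp: acyclic_def)
qed


section \<open>The lower bound\<close>

text \<open>
  Write \<open>u = x s\<close> for a vertex \<open>s\<close> of \<open>L\<close>. In the acyclic reorientation the vertices of \<open>R\<close>
  whose vectors have product \<open>1\<close> with \<open>u\<close> precede \<open>s\<close>, and all the others come after \<open>s\<close>; no
  arc leads from the latter to the former. This leaves room for modifying the form on \<open>R\<close>
  without creating cycles, so as to make it degenerate.
\<close>

lemma inversion_number_less_of_dijoin:
  assumes L: "oriented_graph L" and R: "oriented_graph R"
    and I: "finite I" "even (card I)"
    and ac: "acyclic (reorient (parcs (dijoin L R)) (\<lambda>u v. dot I (x u) (x v)))"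
    and touched: "(p, q) \<in> parcs L" "dot I (x p) (x q) = 1"
  shows "inversion_number R < card I"
proof -
  interpret L: oriented_graph L by fact
  interpret R: oriented_graph R by fact
  define E where "E = reorient (parcs (dijoin L R)) (\<lambda>u v. dot I (x u) (x v))"
  define F where "F = reorient (parcs R) (\<lambda>u v. dot I (x u) (x v))"
  have no_cycle: "(a, a) \<notin> E\<^sup>+" for a
    using ac by (simp add: E_def acyclic_def)
  have FE: "F \<subseteq> E"
    by (auto simp: E_def F_def in_reorient_iff dijoin_def split: if_splits)
  then have acF: "acyclic F"
    using ac acyclic_subset by (auto simp: E_def)
  have before: "(v, s) \<in> E" if "s \<in> pverts L" "v \<in> pverts R" "dot I (x s) (x v) = 1" for s v
    using that by (simp add: E_def in_reorient_iff dijoin_def dot_commute)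
  have after: "(s, v) \<in> E" if "s \<in> pverts L" "v \<in> pverts R" "dot I (x s) (x v) = 0" for s v
    using that by (simp add: E_def in_reorient_iff dijoin_def)
  have monotone: "dot I (x s) (x a) = 1"
    if "s \<in> pverts L" "(a, b) \<in> F" "dot I (x s) (x b) = 1" for s a b
  proof (rule ccontr)
    assume "dot I (x s) (x a) \<noteq> 1"
    moreover have "a \<in> pverts R" "b \<in> pverts R"
      using that(2) R.in_arcsD1 R.in_arcsD2 by (auto simp: F_def in_reorient_iff split: if_splits)
    ultimately have "(s, a) \<in> E" "(a, b) \<in> E" "(b, s) \<in> E"
      using that after before FE by auto
    then show False using no_cycle by (meson trancl.intros)
  qed
  have less: "inversion_number R < card I"
    if "j \<in> I" "acyclic (reorient (parcs R) (\<lambda>u v. dot (I - {j}) (T (x u)) (T (x v))))" for j T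
  proof -
    have "inversion_number R \<le> card (I - {j})"
      using I that by (intro inversion_number_le_card[OF R]) auto
    also have "\<dots> < card I"
      using I that by (intro psubset_card_mono) auto
    finally show ?thesis .
  qed
  show ?thesis
  proof (cases "\<exists>s\<in>pverts L. dot I (x s) (x s) = 1")
    case True
    then obtain s where s: "s \<in> pverts L" "dot I (x s) (x s) = 1" by blast
    define u where "u = x s"
    \<comment> \<open>This is where the parity of \<open>card I\<close> enters: the all-ones vector is isotropic.\<close>
    have "\<exists>j\<in>I. u j = 0"
    proof (rule ccontr)
      assume "\<not> (\<exists>j\<in>I. u j = 0)"
      then have "dot I u u = (\<Sum>i\<in>I. 1)"
        unfolding dot_def by (intro sum.cong) auto
      then show False using I(2) s(2) by (auto simp: u_def elim!: evenE)
    qed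
    then obtain j where j: "j \<in> I" "u j = 0" by blast
    obtain T where T: "dot (I - {j}) (T y) (T z) = dot I y z + dot I u y * dot I u z" for y z
      using drop_coordinate_nonisotropic[of I u j] I(1) s(2) j by (auto simp: u_def)
    define G where "G = reorient (parcs R) (\<lambda>a b. dot (I - {j}) (T (x a)) (T (x b)))"
    \<comment> \<open>The arcs among the vertices before \<open>s\<close>, which are those of level \<open>0\<close>, are reversed.\<close>
    define h :: "'a \<Rightarrow> nat" where "h a = (if dot I u (x a) = 1 then 0 else 1)" for a
    have G: "(a, b) \<in> G \<longleftrightarrow> (if h a = 0 \<and> h b = 0 then (b, a) \<in> F else (a, b) \<in> F)" for a b
      by (auto simp: G_def F_def in_reorient_iff T h_def dot_commute[of I "x b" "x a"])
    have "acyclic G"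
    proof (rule acyclic_by_levels)
      show "h a \<le> h b" if "(a, b) \<in> G" for a b
        using that monotone[OF s(1), of a b, folded u_def]
        by (cases "dot I u (x a)"; cases "dot I u (x b)") (simp_all add: G h_def)
      show "acyclic {(a, b) \<in> G. h a = n \<and> h b = n}" for n
      proof (cases "n = 0")
        case True
        then have "{(a, b) \<in> G. h a = n \<and> h b = n} \<subseteq> F\<inverse>" by (auto simp: G)
        moreover have "acyclic (F\<inverse>)" using acF by simp
        ultimately show ?thesis by (rule acyclic_subset[rotated])
      next
        case False
        then have "{(a, b) \<in> G. h a = n \<and> h b = n} \<subseteq> F" by (auto simp: G)
        with acF show ?thesis by (rule acyclic_subset)
      qed
    qed
    then show ?thesis using less[OF j(1)] by (simp add: G_def)
  next
    case False
    have "\<exists>s t. s \<in> pverts L \<and> t \<in> pverts L \<and> (s, t) \<in> E \<and> dot I (x s) (x t) = 1"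
      using touched L.in_arcsD1[OF touched(1)] L.in_arcsD2[OF touched(1)]
      by (intro exI[of _ q] exI[of _ p])
        (simp add: E_def in_reorient_iff dijoin_def dot_commute)
    then obtain s t where st: "s \<in> pverts L" "t \<in> pverts L" "(s, t) \<in> E" "dot I (x s) (x t) = 1"
      by blast
    define u where "u = x s"
    define w where "w = x t"
    have "dot I u u = 0" "dot I w w = 0" "dot I u w = 1"
      using False st by (auto simp: u_def w_def)
    then obtain j T where j: "j \<in> I" and
      T: "\<And>y z. dot (I - {j}) (T y) (T z)
          = dot I y z + dot I u y * dot I w z + dot I w y * dot I u z"
      by (rule drop_coordinate_hyperbolic[OF I(1)]) (rule that)
    \<comment> \<open>As \<open>s\<close> precedes \<open>t\<close>, whatever precedes \<open>s\<close> also precedes \<open>t\<close>.\<close>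
    have nested: "dot I w (x v) = 1" if "v \<in> pverts R" "dot I u (x v) = 1" for v
    proof (rule ccontr)
      assume "dot I w (x v) \<noteq> 1"
      then have "(v, s) \<in> E" "(s, t) \<in> E" "(t, v) \<in> E"
        using that st before after by (auto simp: u_def w_def)
      then show False using no_cycle by (meson trancl.intros)
    qed
    define G where "G = reorient (parcs R) (\<lambda>a b. dot (I - {j}) (T (x a)) (T (x b)))"
    \<comment> \<open>The new form reverses the arcs between the vertices before \<open>s\<close> and those between \<open>s\<close>
      and \<open>t\<close>, so these two blocks change places.\<close>
    define h :: "'a \<Rightarrow> nat" where
      "h a = (if dot I u (x a) = 1 then 1 else if dot I w (x a) = 1 then 0 else 2)" for a
    have G: "(a, b) \<in> G \<longleftrightarrow>
        (if h a = 0 \<and> h b = 1 \<or> h a = 1 \<and> h b = 0 then (b, a) \<in> F else (a, b) \<in> F)"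
      if "a \<in> pverts R" "b \<in> pverts R" for a b
      using nested[OF that(1)] nested[OF that(2)]
      by (cases "dot I (x a) (x b)"; cases "dot I u (x a)"; cases "dot I w (x a)";
          cases "dot I u (x b)"; cases "dot I w (x b)")
        (simp_all add: G_def F_def in_reorient_iff T h_def dot_commute[of I "x b" "x a"])
    have RG: "a \<in> pverts R" "b \<in> pverts R" if "(a, b) \<in> G" for a b
      using that R.in_arcsD1 R.in_arcsD2 by (auto simp: G_def in_reorient_iff split: if_splits)
    have "acyclic G"
    proof (rule acyclic_by_levels)
      fix a b
      assume ab: "(a, b) \<in> G"
      show "h a \<le> h b"
      proof (cases "h a = 1 \<and> h b = 0")
        case True
        then have "(b, a) \<in> F" using ab G[OF RG[OF ab]] by simp
        moreover have "dot I u (x a) = 1" "dot I u (x b) \<noteq> 1"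
          using True by (simp_all add: h_def split: if_splits)
        ultimately show ?thesis using monotone[OF st(1), of b a] by (simp add: u_def)
      next
        case False
        show ?thesis
        proof (cases "h a = 0")
          case nonzero: False
          then have "(a, b) \<in> F" using ab G[OF RG[OF ab]] False by simp
          then have "dot I u (x b) = 1 \<Longrightarrow> dot I u (x a) = 1"
            "dot I w (x b) = 1 \<Longrightarrow> dot I w (x a) = 1"
            using monotone[OF st(1)] monotone[OF st(2)] by (auto simp: u_def w_def)
          then show ?thesis
            using nonzero False by (cases "dot I w (x b)") (simp_all add: h_def split: if_splits)
        qed simp
      qed
    next
      show "acyclic {(a, b) \<in> G. h a = n \<and> h b = n}" for n
      proof -
        have "(a, b) \<in> F" if "(a, b) \<in> G" "h a = n" "h b = n" for a b
        proof -
          have "\<not> (h a = 0 \<and> h b = 1 \<or> h a = 1 \<and> h b = 0)" using that(2,3) by auto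
          then show ?thesis using that(1) by (simp only: G[OF RG[OF that(1)]] if_False)
        qed
        then have "{(a, b) \<in> G. h a = n \<and> h b = n} \<subseteq> F" by blast
        with acF show ?thesis by (rule acyclic_subset)
      qed
    qed
    then show ?thesis using less[OF j] by (simp add: G_def)
  qed
qed

text \<open>
  By restriction to \<open>R\<close>, a family for \<open>L \<Rightarrow> R\<close> has at least as many sets as \<open>R\<close> requires.
  One with exactly that many reverses no arc of \<open>L\<close>, so it leaves the cycles of \<open>L\<close> intact.
\<close>

lemma inversion_number_dijoin_greater:
  assumes L: "oriented_graph L" and R: "oriented_graph R"
    and disj: "pverts L \<inter> pverts R = {}"
    and "0 < inversion_number L" "even (inversion_number R)"
  shows "inversion_number R < inversion_number (dijoin L R)"
proof (rule ccontr)
  assume neg: "\<not> inversion_number R < inversion_number (dijoin L R)"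
  define n where "n = inversion_number (dijoin L R)"
  obtain x where ac: "acyclic (reorient (parcs (dijoin L R)) (\<lambda>u v. dot {..<n} (x u) (x v)))"
    using inversion_number_attained[OF oriented_graph_dijoin[OF L R disj]] unfolding n_def .
  have "reorient (parcs R) (\<lambda>u v. dot {..<n} (x u) (x v))
      \<subseteq> reorient (parcs (dijoin L R)) (\<lambda>u v. dot {..<n} (x u) (x v))"
    by (auto simp: in_reorient_iff dijoin_def split: if_splits)
  then have "inversion_number R \<le> card {..<n}"
    using ac by (intro inversion_number_le_card[OF R]) (auto intro: acyclic_subset)
  then have n: "inversion_number R = n" using neg by (simp add: n_def)
  show False
  proof (cases "\<exists>p q. (p, q) \<in> parcs L \<and> dot {..<n} (x p) (x q) = 1")
    case True
    then show False
      using inversion_number_less_of_dijoin[OF L R _ _ ac] assms(5) n by auto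
  next
    case False
    then have "parcs L \<subseteq> reorient (parcs (dijoin L R)) (\<lambda>u v. dot {..<n} (x u) (x v))"
      by (auto simp: in_reorient_iff dijoin_def)
    then have "acyclic (parcs L)" using ac by (rule acyclic_subset[rotated])
    then have "inversion_number L \<le> card ({} :: nat set)"
      by (intro inversion_number_le_card[OF L]) (simp_all add: dot_def reorient_def)
    then show False using assms(4) by simp
  qed
qed


section \<open>The upper bound and the reversed dijoin\<close>

lemma inversion_number_dijoin_le:
  assumes L: "oriented_graph L" and R: "oriented_graph R"
    and disj: "pverts L \<inter> pverts R = {}"
  shows "inversion_number (dijoin L R) \<le> inversion_number L + inversion_number R"
proof -
  interpret L: oriented_graph L by fact
  interpret R: oriented_graph R by fact
  define l r where "l = inversion_number L" and "r = inversion_number R"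
  obtain x where x: "acyclic (reorient (parcs L) (\<lambda>u v. dot {..<l} (x u) (x v)))"
    using inversion_number_attained[OF L] unfolding l_def .
  obtain y where y: "acyclic (reorient (parcs R) (\<lambda>u v. dot {..<r} (y u) (y v)))"
    using inversion_number_attained[OF R] unfolding r_def .
  define z where "z v = case_sum (\<lambda>i. if v \<in> pverts L then x v i else 0)
    (\<lambda>i. if v \<in> pverts L then 0 else y v i)" for v
  define E where "E = reorient (parcs (dijoin L R)) (\<lambda>u v. dot ({..<l} <+> {..<r}) (z u) (z v))"
  define h :: "'a \<Rightarrow> nat" where "h v = (if v \<in> pverts L then 0 else 1)" for v
  have z: "dot ({..<l} <+> {..<r}) (z u) (z v) =
     (if u \<in> pverts L \<and> v \<in> pverts L then dot {..<l} (x u) (x v)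
      else if u \<notin> pverts L \<and> v \<notin> pverts L then dot {..<r} (y u) (y v) else 0)" for u v
    by (simp add: dot_def sum.Plus z_def)
  have inside_L: "(a, b) \<in> reorient (parcs L) (\<lambda>u v. dot {..<l} (x u) (x v))"
    if "(a, b) \<in> E" "a \<in> pverts L" "b \<in> pverts L" for a b
    using that disj
    by (auto simp: E_def in_reorient_iff z dijoin_def split: if_splits
        dest: R.in_arcsD1 R.in_arcsD2)
  have inside_R: "(a, b) \<in> reorient (parcs R) (\<lambda>u v. dot {..<r} (y u) (y v))"
    if "(a, b) \<in> E" "a \<notin> pverts L" "b \<notin> pverts L" for a b
    using that
    by (auto simp: E_def in_reorient_iff z dijoin_def split: if_splits
        dest: L.in_arcsD1 L.in_arcsD2)
  have "acyclic E"
  proof (rule acyclic_by_levels)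
    show "h a \<le> h b" if "(a, b) \<in> E" for a b
      using that disj L.in_arcsD1 L.in_arcsD2 R.in_arcsD1 R.in_arcsD2
      by (auto simp: E_def h_def in_reorient_iff z dijoin_def split: if_splits)
    show "acyclic {(a, b) \<in> E. h a = n \<and> h b = n}" for n
    proof (cases "n = 0")
      case True
      then have "{(a, b) \<in> E. h a = n \<and> h b = n}
          \<subseteq> reorient (parcs L) (\<lambda>u v. dot {..<l} (x u) (x v))"
        by (auto simp: h_def intro!: inside_L split: if_splits)
      then show ?thesis using x by (rule acyclic_subset[rotated])
    next
      case False
      then have "{(a, b) \<in> E. h a = n \<and> h b = n}
          \<subseteq> reorient (parcs R) (\<lambda>u v. dot {..<r} (y u) (y v))"
        by (auto simp: h_def intro!: inside_R)
      then show ?thesis using y by (rule acyclic_subset[rotated])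
    qed
  qed
  then have "inversion_number (dijoin L R) \<le> card ({..<l} <+> {..<r})"
    unfolding E_def by (intro inversion_number_le_card[OF oriented_graph_dijoin[OF assms]]) auto
  then show ?thesis by (simp add: card_Plus l_def r_def)
qed

definition converse_digraph :: "'a pair_pre_digraph \<Rightarrow> 'a pair_pre_digraph" where
  "converse_digraph D = \<lparr> pverts = pverts D, parcs = (parcs D)\<inverse> \<rparr>"

lemma pverts_converse_digraph [simp]: "pverts (converse_digraph D) = pverts D"
  by (simp add: converse_digraph_def)

lemma oriented_graph_converse:
  assumes "oriented_graph D"
  shows "oriented_graph (converse_digraph D)"
proof -
  interpret oriented_graph D by fact
  show ?thesis
    by (rule oriented_graphI)
      (use no_2cycles in \<open>auto simp: converse_digraph_def pair_finite_verts
        dest: in_arcsD1 in_arcsD2\<close>)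
qed

lemma inversion_number_converse:
  assumes "oriented_graph D"
  shows "inversion_number (converse_digraph D) = inversion_number D"
proof -
  have "reorient ((parcs D)\<inverse>) g = (reorient (parcs D) g)\<inverse>"
    if "\<And>u v. g u v = g v u" for g
    using that by (auto simp: in_reorient_iff split: if_splits)
  then have "decycling_family (converse_digraph D) Xs \<longleftrightarrow> decycling_family D Xs" for Xs
    unfolding decycling_family_iff[OF assms] decycling_family_iff[OF oriented_graph_converse[OF assms]]
    by (simp add: converse_digraph_def conj_commute)
  then show ?thesis by (simp add: inversion_number_def)
qed

lemma dijoin_converse:
  "dijoin (converse_digraph L) (converse_digraph R) = converse_digraph (dijoin R L)"
  by (auto simp: dijoin_def converse_digraph_def)

theorem theorem1p5:
  fixes k :: nat and L R :: "'a pair_pre_digraph"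
  assumes "2 \<le> k" and "even k"
    and "oriented_graph L" and "oriented_graph R"
    and "pverts L \<inter> pverts R = {}"
    and "inversion_number L = 1" and "inversion_number R = k"
  shows "inversion_number (dijoin L R) = inversion_number (dijoin R L)
    \<and> inversion_number (dijoin R L) = inversion_number L + inversion_number R
    \<and> inversion_number L + inversion_number R = 1 + k"
proof -
  have dijoin: "inversion_number (dijoin A B) = 1 + k"
    if "oriented_graph A" "oriented_graph B" "pverts A \<inter> pverts B = {}"
      "inversion_number A = 1" "inversion_number B = k" for A B :: "'a pair_pre_digraph"
    using inversion_number_dijoin_greater[OF that(1-3)] inversion_number_dijoin_le[OF that(1-3)]
      that(4,5) assms(2) by simp
  have "inversion_number (dijoin (converse_digraph L) (converse_digraph R)) = 1 + k"
    using assms by (intro dijoin) (simp_all add: oriented_graph_converse inversion_number_converse)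
  then have "inversion_number (dijoin R L) = 1 + k"
    using assms by (simp add: dijoin_converse inversion_number_converse oriented_graph_dijoin
        Int_commute)
  moreover have "inversion_number (dijoin L R) = 1 + k"
    using assms by (intro dijoin)
  ultimately show ?thesis using assms(6,7) by simp
qed

end
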